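(* Let $\widehat f(x)=x^\top\widehat\alpha+\widehat g(x)$, where $$(\widehat\alpha,\widehat g)=\operatorname*{arg\,min}_{\alpha\in\mathbb R^d,\ g\in\mathcal H_K}\Big\{\frac1n\sum_{i=1}^n\big(Y_i-X_i^\top\alpha-g(X_i)\big)^2+\lambda\|g\|_K^2\Big\}$$ is computed from the fixed-design data described in the context. Assume $K$ is symmetric and positive semi-definite and $\operatorname{rank}(\mathbb X)=d$. Then for any $\lambda>0$, $$\mathcal R(\widehat f-f^* )\ \le\ \inf_{\alpha\in\mathbb R^d,\ f\in\mathcal H_K}\Big\{\mathcal R(\langle\alpha,\cdot\rangle+f-f^* )+\lambda\|f\|_K^2\Big\}+\frac{\sigma^2}{n}\Big(d+\sum_{i=1}^n\Big(\frac{\widehat\nu_i}{\widehat\nu_i+\lambda}\Big)^2\Big).$$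
   Context: Model and fixed design: $\mathcal X\subseteq\mathbb R^d$, the points $X_1,\dots,X_n\in\mathcal X$ are deterministic, $f^*:\mathcal X\to\mathbb R$ is the regression function, and $Y_i=f^*(X_i)+\epsilon_i$, where $\epsilon_1,\dots,\epsilon_n$ are independent with $\mathbb E[\epsilon_i]=0$ and $\mathbb E[\epsilon_i^2]=\sigma^2$. The design matrix is $\mathbb X=(X_1,\dots,X_n)^\top\in\mathbb R^{n\times d}$. Kernel: $K:\mathcal X\times\mathcal X\to\mathbb R$ is a kernel function; positive semi-definite means every matrix $(K(x_i,x_j))_{i,j}$ for finitely many points is positive semi-definite. $\mathcal H_K$ is the reproducing kernel Hilbert space of $K$, with norm $\|\cdot\|_K$. The kernel matrix $\mathbb K\in\mathbb R^{n\times n}$ has entries $\mathbb K_{ij}=n^{-1}K(X_i,X_j)$. Let $P_{\mathbb X}$ be the orthogonal projection matrix onto the column space of $\mathbb X$ and $Q_{\mathbb X}=\mathbb I_n-P_{\mathbb X}$. The eigenvalues of $Q_{\mathbb X}\mathbb KQ_{\mathbb X}$ are $\widehat\nu_1\ge\cdots\ge\widehat\nu_n\ge0$. Risk: for a (possibly data-dependent) function $f:\mathcal X\to\mathbb R$, $\mathcal R(f-f^* )=\frac1n\sum_{i=1}^n\mathbb E[(f(X_i)-f^*(X_i))^2]$; the expectation is over the noise. $\langle\alpha,\cdot\rangle$ denotes the linear function $x\mapsto x^\top\alpha$. *)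

theory Defs
  imports "HOL-Probability.Probability" "HOL-Computational_Algebra.Polynomial"
begin

section \<open>Kernels and reproducing kernel Hilbert spaces\<close>

definition symmetric_kernel :: "'a set \<Rightarrow> ('a \<Rightarrow> 'a \<Rightarrow> real) \<Rightarrow> bool" where
  "symmetric_kernel S K \<longleftrightarrow> (\<forall>x\<in>S. \<forall>y\<in>S. K x y = K y x)"

definition psd_kernel :: "'a set \<Rightarrow> ('a \<Rightarrow> 'a \<Rightarrow> real) \<Rightarrow> bool" where
  "psd_kernel S K \<longleftrightarrow>
     (\<forall>(m::nat) (p :: nat \<Rightarrow> 'a) (c :: nat \<Rightarrow> real).
        (\<forall>i<m. p i \<in> S) \<longrightarrow> 0 \<le> (\<Sum>i<m. \<Sum>j<m. c i * c j * K (p i) (p j)))"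

text \<open>
  A function on the set \<open>S\<close> is represented by a function on the whole type that vanishes
  outside \<open>S\<close>, so that equality of representatives is equality on \<open>S\<close>.
  The inner product \<open>ip\<close> is only meaningful on \<open>H\<close>.
\<close>

locale hilbert_function_space =
  fixes S :: "'a set"
    and H :: "('a \<Rightarrow> real) set"
    and ip :: "('a \<Rightarrow> real) \<Rightarrow> ('a \<Rightarrow> real) \<Rightarrow> real"
  assumes vanish_outside: "\<lbrakk>f \<in> H; x \<notin> S\<rbrakk> \<Longrightarrow> f x = 0"
    and zero_mem: "(\<lambda>_. 0) \<in> H"
    and add_mem: "\<lbrakk>f \<in> H; g \<in> H\<rbrakk> \<Longrightarrow> (\<lambda>x. f x + g x) \<in> H"
    and scale_mem: "f \<in> H \<Longrightarrow> (\<lambda>x. c * f x) \<in> H"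
    and ip_commute: "\<lbrakk>f \<in> H; g \<in> H\<rbrakk> \<Longrightarrow> ip f g = ip g f"
    and ip_add_left:
      "\<lbrakk>f \<in> H; g \<in> H; h \<in> H\<rbrakk> \<Longrightarrow> ip (\<lambda>x. f x + g x) h = ip f h + ip g h"
    and ip_scale_left: "\<lbrakk>f \<in> H; g \<in> H\<rbrakk> \<Longrightarrow> ip (\<lambda>x. c * f x) g = c * ip f g"
    and ip_nonneg: "f \<in> H \<Longrightarrow> 0 \<le> ip f f"
    and ip_eq_zero: "\<lbrakk>f \<in> H; ip f f = 0\<rbrakk> \<Longrightarrow> f = (\<lambda>_. 0)"
    and complete:
      "\<lbrakk>\<And>k. F k \<in> H;
        \<And>e. e > 0 \<Longrightarrow>
          \<exists>N. \<forall>k\<ge>N. \<forall>l\<ge>N. sqrt (ip (\<lambda>x. F k x - F l x) (\<lambda>x. F k x - F l x)) < e\<rbrakk>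
       \<Longrightarrow> \<exists>f\<in>H. (\<lambda>k. sqrt (ip (\<lambda>x. F k x - f x) (\<lambda>x. F k x - f x))) \<longlonglongrightarrow> 0"

definition kernel_section :: "'a set \<Rightarrow> ('a \<Rightarrow> 'a \<Rightarrow> real) \<Rightarrow> 'a \<Rightarrow> 'a \<Rightarrow> real" where
  "kernel_section S K x = (\<lambda>y. if y \<in> S then K x y else 0)"

text \<open>By the Moore--Aronszajn theorem, every symmetric positive semi-definite kernel \<open>K\<close>
  on \<open>S\<close> has exactly one \<open>(H, ip)\<close> of this kind (up to the values of \<open>ip\<close> outside \<open>H\<close>).\<close>

locale rkhs = hilbert_function_space S H ip
  for S :: "'a set"
    and K :: "'a \<Rightarrow> 'a \<Rightarrow> real"
    and H :: "('a \<Rightarrow> real) set"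
    and ip :: "('a \<Rightarrow> real) \<Rightarrow> ('a \<Rightarrow> real) \<Rightarrow> real" +
  assumes section_mem: "x \<in> S \<Longrightarrow> kernel_section S K x \<in> H"
    and reproducing: "\<lbrakk>f \<in> H; x \<in> S\<rbrakk> \<Longrightarrow> ip f (kernel_section S K x) = f x"

definition rkhs_norm :: "(('a \<Rightarrow> real) \<Rightarrow> ('a \<Rightarrow> real) \<Rightarrow> real) \<Rightarrow> ('a \<Rightarrow> real) \<Rightarrow> real" where
  "rkhs_norm ip f = sqrt (ip f f)"

section \<open>Matrices\<close>

definition design_matrix :: "('n \<Rightarrow> real ^ 'd) \<Rightarrow> real ^ 'd ^ 'n" where
  "design_matrix X = (\<chi> i. X i)"

definition kernel_matrix :: "('a \<Rightarrow> 'a \<Rightarrow> real) \<Rightarrow> ('n::finite \<Rightarrow> 'a) \<Rightarrow> real ^ 'n ^ 'n" where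
  "kernel_matrix K X = (\<chi> i j. K (X i) (X j) / real CARD('n))"

definition orth_proj_matrix :: "(real ^ 'n) set \<Rightarrow> real ^ 'n ^ 'n" where
  "orth_proj_matrix V = (THE P. \<forall>v. P *v v \<in> V \<and> (\<forall>w\<in>V. orthogonal (v - P *v v) w))"

definition proj_P :: "real ^ 'd ^ 'n \<Rightarrow> real ^ 'n ^ 'n" where
  "proj_P A = orth_proj_matrix (span (columns A))"

definition proj_Q :: "real ^ 'd ^ 'n \<Rightarrow> real ^ 'n ^ 'n" where
  "proj_Q A = mat 1 - proj_P A"

definition charpoly :: "'a::comm_ring_1 ^ 'n ^ 'n \<Rightarrow> 'a poly" where
  "charpoly A = det (mat [:0, 1:] - map_matrix (\<lambda>a. [:a:]) A)"

text \<open>The \<open>i\<close>-th largest eigenvalue, counted with algebraic multiplicity and starting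
  from \<open>i = 1\<close>. It is meaningful when all roots of the characteristic polynomial are real,
  in particular for symmetric \<open>A\<close>.\<close>

definition eigval_desc :: "real ^ 'n ^ 'n \<Rightarrow> nat \<Rightarrow> real" where
  "eigval_desc A i = rev (sorted_list_of_multiset (proots (charpoly A))) ! (i - 1)"

section \<open>Estimator and risk\<close>

definition pls_objective ::
  "((real ^ 'd \<Rightarrow> real) \<Rightarrow> (real ^ 'd \<Rightarrow> real) \<Rightarrow> real) \<Rightarrow> real \<Rightarrow> ('n::finite \<Rightarrow> real ^ 'd) \<Rightarrow>
   ('n \<Rightarrow> real) \<Rightarrow> (real ^ 'd) \<times> (real ^ 'd \<Rightarrow> real) \<Rightarrow> real" where
  "pls_objective ip lam X Y = (\<lambda>(\<alpha>, g).
     (\<Sum>i\<in>UNIV. (Y i - X i \<bullet> \<alpha> - g (X i))\<^sup>2) / real CARD('n) + lam * (rkhs_norm ip g)\<^sup>2)"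

definition pls_argmin ::
  "(real ^ 'd \<Rightarrow> real) set \<Rightarrow> ((real ^ 'd \<Rightarrow> real) \<Rightarrow> (real ^ 'd \<Rightarrow> real) \<Rightarrow> real) \<Rightarrow> real \<Rightarrow>
   ('n::finite \<Rightarrow> real ^ 'd) \<Rightarrow> ('n \<Rightarrow> real) \<Rightarrow> (real ^ 'd) \<times> (real ^ 'd \<Rightarrow> real)" where
  "pls_argmin H ip lam X Y = arg_min (pls_objective ip lam X Y) (\<lambda>(\<alpha>, g). g \<in> H)"

definition pls_fit ::
  "(real ^ 'd \<Rightarrow> real) set \<Rightarrow> ((real ^ 'd \<Rightarrow> real) \<Rightarrow> (real ^ 'd \<Rightarrow> real) \<Rightarrow> real) \<Rightarrow> real \<Rightarrow>
   ('n::finite \<Rightarrow> real ^ 'd) \<Rightarrow> ('n \<Rightarrow> real) \<Rightarrow> real ^ 'd \<Rightarrow> real" where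
  "pls_fit H ip lam X Y = (case pls_argmin H ip lam X Y of (\<alpha>, g) \<Rightarrow> (\<lambda>x. x \<bullet> \<alpha> + g x))"

text \<open>The function \<open>h \<omega>\<close> may depend on the noise through the sample point \<open>\<omega>\<close>.\<close>

definition risk :: "'w measure \<Rightarrow> ('n::finite \<Rightarrow> 'a) \<Rightarrow> ('w \<Rightarrow> 'a \<Rightarrow> real) \<Rightarrow> real" where
  "risk M X h = (\<Sum>i\<in>UNIV. (\<integral>\<omega>. (h \<omega> (X i))\<^sup>2 \<partial>M)) / real CARD('n)"

end

theory Submission
  imports Defs
begin

text \<open>The fitted values of the penalised estimator depend linearly on the data. Write \<open>P\<close> for the
  projection onto the column space of the design matrix, \<open>Q = 1 - P\<close>, \<open>\<K>\<close> for the kernel matrix,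
  \<open>A = Q \<K> Q\<close> and \<open>R = (A + lam)\<^sup>-\<^sup>1\<close>. Then the residual vector is \<open>W y\<close> with \<open>W = lam R Q\<close>, and the
  fitted values are \<open>B y\<close> with \<open>B = 1 - W = P + A R\<close>. To see this, one exhibits a pair
  \<open>(\<alpha>\<^sub>0, g\<^sub>0)\<close> with residual \<open>W y\<close> that solves the normal equations (\<open>minimiser_exists\<close>, where \<open>g\<^sub>0\<close> is a
  kernel expansion at the design points). Since the objective is quadratic, it exceeds its value at this
  pair by a nonnegative form that vanishes only if the fitted values agree
  (\<open>pls_objective_decomposition\<close>). Therefore the minimum is attained, and every minimiser has the
  fitted values \<open>B y\<close> (\<open>eval_pls_fit\<close>).

  For data \<open>y = f + \<epsilon>\<close> with uncorrelated noise the risk of the linear smoother \<open>B\<close> is exactly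
  \<open>\<bar>W f\<bar>\<^sup>2 / n + \<sigma>\<^sup>2 tr (B\<^sup>2) / n\<close> (\<open>risk_pls_fit\<close>).

  The bias term \<open>\<bar>W f\<bar>\<^sup>2 / n\<close> is the mean squared residual of the fit to the noise-free data \<open>f\<close>, so it
  is at most the minimum of the objective for these data (\<open>residual_le_objective\<close>). That minimum is the
  infimum in the bound, because the risk of a nonrandom function is its mean squared error at the
  design points.

  In the variance term \<open>P\<close> and \<open>A R\<close> annihilate each other, so \<open>tr (B\<^sup>2) = tr P + tr ((A R)\<^sup>2)\<close>
  (\<open>trace_smoother_squared\<close>). The first trace is \<open>d\<close> by the full rank assumption. For the second, \<open>A\<close> is
  diagonalised by an orthogonal matrix (\<open>symmetric_matrix_diagonalizable\<close>), which gives \<open>A R\<close> the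
  eigenvalues \<open>\<nu> / (\<nu> + lam)\<close> and identifies the \<open>\<nu>\<close> with the roots of the characteristic polynomial of
  \<open>A\<close> (\<open>sum_eigval_desc\<close>).\<close>

section \<open>The spectral theorem for real symmetric matrices\<close>

lemma matrix_diff_ldistrib: "A ** (B - C) = A ** B - A ** (C :: real ^ 'n ^ 'm)"
  by (simp add: matrix_matrix_mult_def vec_eq_iff right_diff_distrib sum_subtractf)

lemma matrix_diff_rdistrib: "(A - B) ** C = A ** C - B ** (C :: real ^ 'n ^ 'm)"
  by (simp add: matrix_matrix_mult_def vec_eq_iff left_diff_distrib sum_subtractf)

definition diag_matrix :: "('n \<Rightarrow> 'a::zero) \<Rightarrow> 'a ^ 'n ^ 'n" where
  "diag_matrix d = (\<chi> i j. if i = j then d i else 0)"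

lemma diag_matrix_mult:
  "diag_matrix (a :: 'n::finite \<Rightarrow> real) ** diag_matrix b = diag_matrix (\<lambda>i. a i * b i)"
proof -
  have "(\<Sum>k\<in>UNIV. (if i = k then a i else 0) * (if k = j then b k else 0))
      = (if i = j then a i * b i else 0)" for i j
    by (subst sum.remove[of _ i]) (auto intro!: sum.neutral)
  thus ?thesis by (simp add: diag_matrix_def matrix_matrix_mult_def vec_eq_iff)
qed

lemma trace_diag_matrix: "trace (diag_matrix d) = (\<Sum>i\<in>UNIV. d i)"
  by (simp add: trace_def diag_matrix_def)

lemma matrix_mult_diag_column:
  fixes U :: "real ^ 'n ^ 'n"
  shows "column i (U ** diag_matrix d) = d i *\<^sub>R column i U"
proof -
  have "(\<Sum>k\<in>UNIV. U $ j $ k * (if k = i then d k else 0)) = d i * U $ j $ i" for j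
    by (subst sum.remove[of _ i]) (auto intro!: sum.neutral)
  thus ?thesis by (simp add: column_def diag_matrix_def matrix_matrix_mult_def vec_eq_iff)
qed

lemma symmetric_matrix_inner:
  fixes A :: "real ^ 'n ^ 'n"
  assumes "transpose A = A"
  shows "x \<bullet> (A *v y) = (A *v x) \<bullet> y"
  using assms by (simp flip: dot_lmul_matrix transpose_matrix_vector)

text \<open>A maximiser \<open>v\<close> of the Rayleigh quotient \<open>x \<bullet> A x\<close> over the unit sphere of \<open>T\<close> is an eigenvector:
  it exists by compactness, and the first-order condition in the direction
  \<open>w = \<mu> v - A v\<close>, which lies in \<open>T\<close> because \<open>T\<close> is invariant, forces \<open>w = 0\<close>.\<close>
lemma exists_eigenvector_in_subspace:
  fixes A :: "real ^ 'n ^ 'n"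
  assumes sym: "transpose A = A" and T: "subspace T"
    and inv: "\<And>x. x \<in> T \<Longrightarrow> A *v x \<in> T" and "z \<in> T" "z \<noteq> 0"
  obtains v \<mu> where "v \<in> T" "norm v = 1" "A *v v = \<mu> *\<^sub>R v"
proof -
  define q where "q x = x \<bullet> (A *v x)" for x
  have "compact (sphere 0 1 \<inter> T)"
    by (intro compact_Int_closed closed_subspace T compact_sphere)
  moreover have "(1 / norm z) *\<^sub>R z \<in> sphere 0 1 \<inter> T"
    using subspace_scale[OF T \<open>z \<in> T\<close>] \<open>z \<noteq> 0\<close> by simp
  moreover have "continuous_on (sphere 0 1 \<inter> T) q"
    unfolding q_def
    by (intro continuous_intros matrix_vector_mult_linear_continuous_on)
  ultimately obtain v where v: "v \<in> sphere 0 1 \<inter> T" "\<And>x. x \<in> sphere 0 1 \<inter> T \<Longrightarrow> q x \<le> q v"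
    using continuous_attains_sup[of "sphere 0 1 \<inter> T" q] by blast
  define \<mu> where "\<mu> = q v"
  have v1: "norm v = 1" "v \<in> T" using v by auto
  have qle: "q x \<le> \<mu> * (x \<bullet> x)" if "x \<in> T" for x
  proof (cases "x = 0")
    case False
    have "q ((1 / norm x) *\<^sub>R x) \<le> \<mu>"
      unfolding \<mu>_def using False that by (intro v(2)) (auto intro: subspace_scale T)
    moreover have "q ((1 / norm x) *\<^sub>R x) = q x / (norm x)\<^sup>2"
      by (simp add: q_def matrix_vector_mult_scaleR power2_eq_square)
    ultimately have "q x / (norm x)\<^sup>2 \<le> \<mu>" by simp
    hence "q x \<le> \<mu> * (norm x)\<^sup>2"
      using False by (subst (asm) pos_divide_le_eq) auto
    thus ?thesis by (simp add: power2_norm_eq_inner)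
  qed (simp add: q_def)
  define w where "w = \<mu> *\<^sub>R v - A *v v"
  have wT: "w \<in> T"
    unfolding w_def using v1 by (intro subspace_diff subspace_scale T inv)
  define c where "c = \<mu> * (w \<bullet> w) - q w"
  \<comment> \<open>The form \<open>x \<mapsto> \<mu> (x \<bullet> x) - q x\<close> is nonnegative on \<open>T\<close> and vanishes at \<open>v\<close>, so its
     expansion along \<open>v + t w\<close> cannot have a linear term.\<close>
  have expand: "0 \<le> 2 * t * (w \<bullet> w) + t\<^sup>2 * c" for t
  proof -
    have le: "q (v + t *\<^sub>R w) \<le> \<mu> * ((v + t *\<^sub>R w) \<bullet> (v + t *\<^sub>R w))"
      by (intro qle subspace_add subspace_scale T wT v1)
    have "v \<bullet> (A *v w) = w \<bullet> (A *v v)"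
      using symmetric_matrix_inner[OF sym, of v w] by (simp add: inner_commute)
    hence q: "q (v + t *\<^sub>R w) = \<mu> + 2 * t * (w \<bullet> (A *v v)) + t\<^sup>2 * q w"
      unfolding q_def \<mu>_def matrix_vector_right_distrib matrix_vector_mult_scaleR
      by (simp add: inner_add_left inner_add_right power2_eq_square distrib_left mult.assoc)
    have n: "(v + t *\<^sub>R w) \<bullet> (v + t *\<^sub>R w) = 1 + 2 * t * (v \<bullet> w) + t\<^sup>2 * (w \<bullet> w)"
      using v1 by (simp add: inner_add_left inner_add_right power2_eq_square distrib_left mult.assoc
          inner_commute[of w v] norm_eq_1)
    have "w \<bullet> w = w \<bullet> (\<mu> *\<^sub>R v - A *v v)" by (simp add: w_def)
    also have "\<dots> = \<mu> * (v \<bullet> w) - w \<bullet> (A *v v)"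
      by (simp add: inner_diff_right inner_commute[of w v])
    finally have ww: "w \<bullet> (A *v v) = \<mu> * (v \<bullet> w) - w \<bullet> w" by linarith
    have "2 * t * (w \<bullet> w) + t\<^sup>2 * c = \<mu> * (1 + 2 * t * (v \<bullet> w) + t\<^sup>2 * (w \<bullet> w))
        - (\<mu> + 2 * t * (\<mu> * (v \<bullet> w) - w \<bullet> w) + t\<^sup>2 * q w)"
      unfolding c_def by algebra
    thus ?thesis using le unfolding q n ww by linarith
  qed
  have "w \<bullet> w = 0"
  proof (rule ccontr)
    assume nz: "w \<bullet> w \<noteq> 0"
    define b where "b = w \<bullet> w"
    have b: "b > 0" using nz by (simp add: b_def)
    \<comment> \<open>Small enough in size for the linear term of the expansion to dominate, and of the sign
       that makes it negative.\<close>
    define t where "t = - b / (1 + \<bar>c\<bar>)"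
    have "t * (2 * b + t * c) \<ge> 0"
    proof -
      have "t * (2 * b + t * c) = 2 * t * (w \<bullet> w) + t\<^sup>2 * c"
        by (simp add: b_def power2_eq_square distrib_left mult.assoc)
      thus ?thesis using expand[of t] by simp
    qed
    moreover have "t < 0" using b by (simp add: t_def divide_neg_pos)
    moreover have "2 * b + t * c > 0"
    proof -
      have "b * c \<le> b * \<bar>c\<bar>" "0 \<le> b * \<bar>c\<bar>"
        using b mult_left_mono[of c "\<bar>c\<bar>" b] by simp_all
      hence "b * c < 2 * b * (1 + \<bar>c\<bar>)"
        using b unfolding distrib_left by linarith
      hence "b * c / (1 + \<bar>c\<bar>) < 2 * b"
        by (subst pos_divide_less_eq) (auto intro: add_pos_nonneg)
      thus ?thesis by (simp add: t_def)
    qed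
    ultimately show False
      using mult_neg_pos[of t "2 * b + t * c"] by linarith
  qed
  hence "A *v v = \<mu> *\<^sub>R v" by (simp add: w_def)
  thus thesis by (rule that[OF v1(2,1)])
qed

text \<open>The orthogonal complement of a set of eigenvectors of a symmetric matrix is invariant, so a
  family of fewer than \<open>CARD('n)\<close> orthonormal eigenvectors always extends by one more.\<close>
lemma orthonormal_eigenvectors_exist:
  fixes A :: "real ^ 'n ^ 'n"
  assumes sym: "transpose A = A" and "k \<le> CARD('n)"
  shows "\<exists>B. finite B \<and> card B = k \<and> pairwise orthogonal B \<and>
           (\<forall>b\<in>B. norm b = 1 \<and> (\<exists>\<mu>. A *v b = \<mu> *\<^sub>R b))"
  using assms(2)
proof (induction k)
  case 0
  show ?case by (intro exI[of _ "{}"]) (auto simp: pairwise_def)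
next
  case (Suc k)
  then obtain B where B: "finite B" "card B = k" "pairwise orthogonal B"
    "\<And>b. b \<in> B \<Longrightarrow> norm b = 1" "\<And>b. b \<in> B \<Longrightarrow> \<exists>\<mu>. A *v b = \<mu> *\<^sub>R b"
    by auto
  define T where "T = {x. \<forall>b\<in>B. orthogonal x b}"
  have "dim B < DIM(real ^ 'n)"
    using dim_le_card[OF span_superset, of B] B Suc.prems by simp
  then obtain z where z: "z \<noteq> 0" "\<And>y. y \<in> span B \<Longrightarrow> orthogonal z y"
    using orthogonal_to_subspace_exists by blast
  hence zT: "z \<in> T" by (auto simp: T_def span_base)
  have subT: "subspace T"
    by (auto simp: T_def subspace_def orthogonal_clauses)
  have invT: "A *v x \<in> T" if "x \<in> T" for x
    unfolding T_def
  proof safe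
    fix b assume "b \<in> B"
    then obtain \<mu> where "A *v b = \<mu> *\<^sub>R b" using B by blast
    thus "orthogonal (A *v x) b"
      using that \<open>b \<in> B\<close> symmetric_matrix_inner[OF sym, of x b]
      by (simp add: T_def orthogonal_def)
  qed
  obtain v \<mu> where v: "v \<in> T" "norm v = 1" "A *v v = \<mu> *\<^sub>R v"
    using exists_eigenvector_in_subspace[OF sym subT invT zT z(1)] by blast
  have "v \<notin> B"
    using v by (auto simp: T_def orthogonal_def)
  thus ?case
    using B v by (intro exI[of _ "insert v B"])
      (auto simp: T_def pairwise_insert orthogonal_commute)
qed

theorem symmetric_matrix_diagonalizable:
  fixes A :: "real ^ 'n ^ 'n"
  assumes sym: "transpose A = A"
  obtains U d where "orthogonal_matrix U" "A ** U = U ** diag_matrix d"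
proof -
  obtain B where B: "finite B" "card B = CARD('n)" "pairwise orthogonal B"
    "\<And>b. b \<in> B \<Longrightarrow> norm b = 1" "\<And>b. b \<in> B \<Longrightarrow> \<exists>\<mu>. A *v b = \<mu> *\<^sub>R b"
    using orthonormal_eigenvectors_exist[OF sym order.refl] by auto
  obtain u where u: "bij_betw u (UNIV :: 'n set) B"
    using finite_same_card_bij[of "UNIV :: 'n set" B] B by auto
  obtain d where d: "A *v u i = d i *\<^sub>R u i" for i
  proof -
    have "\<forall>i. \<exists>\<mu>. A *v u i = \<mu> *\<^sub>R u i" using B(5) bij_betwE[OF u] by blast
    thus ?thesis using that by metis
  qed
  define U where "U = transpose (\<chi> i. u i)"
  have col: "column i U = u i" for i
    by (simp add: U_def column_def transpose_def vec_eq_iff)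
  have "orthogonal_matrix U"
    unfolding orthogonal_matrix_orthonormal_columns col
    using B(3,4) u by (auto simp: bij_betw_def pairwise_def inj_on_def) metis+
  moreover have "A ** U = U ** diag_matrix d"
  proof -
    have "column i (A ** U) = column i (U ** diag_matrix d)" for i
    proof -
      have "column i (A ** U) = A *v column i U"
        by (simp add: column_def matrix_matrix_mult_def matrix_vector_mult_def vec_eq_iff)
      thus ?thesis by (simp add: matrix_mult_diag_column col d)
    qed
    thus ?thesis by (simp add: column_def vec_eq_iff)
  qed
  ultimately show thesis using that by blast
qed

lemma trace_conjugated_diag:
  fixes U T :: "real ^ 'n ^ 'n"
  assumes U: "orthogonal_matrix U" and T: "T ** U = U ** diag_matrix d"
  shows "trace T = (\<Sum>i\<in>UNIV. d i)"
proof -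
  have "T = T ** U ** transpose U"
    using U by (simp add: orthogonal_matrix_def flip: matrix_mul_assoc)
  hence "trace T = trace (U ** diag_matrix d ** transpose U)" by (simp add: T)
  also have "\<dots> = trace (transpose U ** (U ** diag_matrix d))" by (rule trace_mul_sym)
  finally have "trace T = trace (transpose U ** (U ** diag_matrix d))" .
  thus ?thesis
    using U by (simp add: orthogonal_matrix_def matrix_mul_assoc trace_diag_matrix)
qed

section \<open>Roots of the characteristic polynomial\<close>

text \<open>Evaluation at \<open>z\<close> commutes with the determinant, so identities between characteristic
  polynomials reduce to identities between determinants of real matrices.\<close>
lemma poly_charpoly: "poly (charpoly A) z = det (mat z - A)" for A :: "real ^ 'n ^ 'n"
proof -
  have entry: "poly ((mat [:0, 1:] - map_matrix (\<lambda>a. [:a:]) A) $ i $ j) z = (mat z - A) $ i $ j"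
    for i j
    by (simp add: mat_def map_matrix_def)
  show ?thesis
    unfolding charpoly_def det_def
    by (simp add: poly_sum poly_prod entry del: vector_minus_component)
qed

lemma charpoly_conjugated_diag:
  fixes U A :: "real ^ 'n ^ 'n"
  assumes U: "orthogonal_matrix U" and A: "A ** U = U ** diag_matrix d"
  shows "charpoly A = (\<Prod>i\<in>UNIV. [:- d i, 1:])"
proof (rule poly_eq_poly_eq_iff[THEN iffD1], rule ext)
  fix z
  have "A = A ** U ** transpose U"
    using U by (simp add: orthogonal_matrix_def flip: matrix_mul_assoc)
  also have "\<dots> = U ** diag_matrix d ** transpose U" by (simp add: A)
  finally have A': "A = U ** diag_matrix d ** transpose U" .
  have z: "mat z = U ** mat z ** transpose U"
  proof -
    have "mat z = z *\<^sub>R (mat 1 :: real ^ 'n ^ 'n)" by (simp add: mat_def vec_eq_iff)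
    thus ?thesis using U
      by (simp add: orthogonal_matrix_def matrix_scalar_ac flip: scalar_matrix_assoc)
  qed
  have "mat z - A = U ** (mat z - diag_matrix d) ** transpose U"
    by (subst z, subst A') (simp add: matrix_diff_ldistrib matrix_diff_rdistrib)
  moreover have "det U * det (transpose U) = 1"
    using U by (metis det_I det_mul orthogonal_matrix_def)
  ultimately have "det (mat z - A) = det (mat z - diag_matrix d)"
    by (simp add: det_mul)
  also have "\<dots> = (\<Prod>i\<in>UNIV. z - d i)"
    by (subst det_diagonal) (auto simp: mat_def diag_matrix_def)
  finally show "poly (charpoly A) z = poly (\<Prod>i\<in>UNIV. [:- d i, 1:]) z"
    by (simp add: poly_charpoly poly_prod)
qed

text \<open>The enumeration \<open>eigval_desc A\<close> and the diagonal entries \<open>d\<close> list the same multiset, the roots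
  of the characteristic polynomial. Symmetric functions of the eigenvalues can therefore be computed
  from any orthogonal diagonalisation.\<close>
lemma sum_eigval_desc:
  fixes A U :: "real ^ 'n ^ 'n"
  assumes "orthogonal_matrix U" "A ** U = U ** diag_matrix d"
  shows "(\<Sum>i = 1..CARD('n). \<phi> (eigval_desc A i)) = (\<Sum>i\<in>UNIV. \<phi> (d i) :: real)"
proof -
  define L where "L = rev (sorted_list_of_multiset (proots (charpoly A)))"
  have roots: "proots (charpoly A) = image_mset d (mset_set UNIV)"
    by (simp add: charpoly_conjugated_diag[OF assms] proots_prod sum_unfold_sum_mset)
  have mset: "mset L = image_mset d (mset_set UNIV)" by (simp add: L_def roots)
  have len: "length L = CARD('n)"
    using arg_cong[OF mset, of size] by simp
  have "(\<Sum>i = 1..CARD('n). \<phi> (eigval_desc A i)) = (\<Sum>i<CARD('n). \<phi> (L ! i))"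
    by (rule sum.reindex_bij_witness[of _ Suc "\<lambda>i. i - 1"])
      (auto simp: eigval_desc_def L_def)
  also have "\<dots> = sum_list (map \<phi> L)"
    by (simp add: sum_list_sum_nth len atLeast0LessThan)
  also have "\<dots> = sum_mset (image_mset \<phi> (mset L))"
    by (simp flip: sum_mset_sum_list)
  also have "\<dots> = (\<Sum>i\<in>UNIV. \<phi> (d i))"
    by (simp add: mset sum_unfold_sum_mset image_mset.compositionality comp_def)
  finally show ?thesis .
qed

section \<open>Ridge regularisation of a positive semidefinite matrix\<close>

definition shift :: "real ^ 'n ^ 'n \<Rightarrow> real \<Rightarrow> real ^ 'n ^ 'n" where
  "shift A lam = A + lam *\<^sub>R mat 1"

definition resolvent :: "real ^ 'n ^ 'n \<Rightarrow> real \<Rightarrow> real ^ 'n ^ 'n" where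
  "resolvent A lam = matrix_inv (shift A lam)"

lemma shift_mult_vec: "shift A lam *v x = A *v x + lam *\<^sub>R x"
  by (simp add: shift_def matrix_vector_mult_add_rdistrib flip: scaleR_matrix_vector_assoc)

lemma matrix_mult_scaleR_id:
  fixes A :: "real ^ 'n ^ 'n"
  shows "A ** (c *\<^sub>R mat 1) = c *\<^sub>R A" "(c *\<^sub>R mat 1) ** A = c *\<^sub>R A"
proof -
  show "A ** (c *\<^sub>R mat 1) = c *\<^sub>R A"
    using matrix_scalar_ac[of A c "mat 1"] scalar_matrix_assoc[of c A "mat 1"] by simp
  show "(c *\<^sub>R mat 1) ** A = c *\<^sub>R A"
    using scalar_matrix_assoc[of c "mat 1" A] by simp
qed

lemma matrix_add_rdistrib: "(A + B) ** C = A ** C + B ** (C :: real ^ 'n ^ 'm)"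
  by (simp add: matrix_matrix_mult_def vec_eq_iff distrib_right sum.distrib)

lemma invertible_shift:
  fixes A :: "real ^ 'n ^ 'n"
  assumes psd: "\<And>x. 0 \<le> x \<bullet> (A *v x)" and "lam > 0"
  shows "invertible (shift A lam)"
proof -
  have "x = 0" if "shift A lam *v x = 0" for x
  proof -
    have "x \<bullet> (A *v x) + lam * (x \<bullet> x) = 0"
      using arg_cong[OF that, of "inner x"] by (simp add: shift_mult_vec inner_add_right)
    moreover have "0 \<le> lam * (x \<bullet> x)" using \<open>lam > 0\<close> by simp
    ultimately have "lam * (x \<bullet> x) = 0" using psd[of x] by linarith
    thus ?thesis using \<open>lam > 0\<close> by simp
  qed
  thus ?thesis
    unfolding invertible_left_inverse matrix_left_invertible_ker by blast
qed

lemma matrix_inv_cancel: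
  fixes B :: "real ^ 'n ^ 'n"
  assumes "invertible B"
  shows "B ** matrix_inv B = mat 1" "matrix_inv B ** B = mat 1"
  using someI_ex[OF assms[unfolded invertible_def]] by (auto simp: matrix_inv_def)

lemma resolvent_cancel:
  fixes A :: "real ^ 'n ^ 'n"
  assumes psd: "\<And>x. 0 \<le> x \<bullet> (A *v x)" and "lam > 0"
  shows "resolvent A lam ** shift A lam = mat 1" "shift A lam ** resolvent A lam = mat 1"
  using matrix_inv_cancel[OF invertible_shift[of A lam]] assms by (auto simp: resolvent_def)

text \<open>The resolvent is diagonal in the same orthonormal basis; nonnegative eigenvalues keep all the
  denominators positive.\<close>
lemma resolvent_diag:
  fixes A U :: "real ^ 'n ^ 'n"
  assumes psd: "\<And>x. 0 \<le> x \<bullet> (A *v x)" and lam: "lam > 0" and d: "\<And>i. 0 \<le> d i"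
    and A: "A ** U = U ** diag_matrix d"
  shows "resolvent A lam ** U = U ** diag_matrix (\<lambda>i. 1 / (d i + lam))"
proof -
  have one: "diag_matrix (\<lambda>i. (d i + lam) * (1 / (d i + lam))) = (mat 1 :: real ^ 'n ^ 'n)"
    using d lam by (simp add: diag_matrix_def mat_def vec_eq_iff add_nonneg_pos less_imp_neq[symmetric])
  have "diag_matrix (\<lambda>i. d i + lam) = diag_matrix d + lam *\<^sub>R (mat 1 :: real ^ 'n ^ 'n)"
    by (simp add: diag_matrix_def mat_def vec_eq_iff)
  hence "shift A lam ** U = U ** diag_matrix (\<lambda>i. d i + lam)"
    by (simp add: shift_def matrix_add_ldistrib matrix_add_rdistrib A matrix_mult_scaleR_id)
  hence "resolvent A lam ** (shift A lam ** U) ** diag_matrix (\<lambda>i. 1 / (d i + lam))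
      = resolvent A lam ** (U ** diag_matrix (\<lambda>i. d i + lam)) ** diag_matrix (\<lambda>i. 1 / (d i + lam))"
    by simp
  also have "\<dots> = resolvent A lam ** U ** (diag_matrix (\<lambda>i. d i + lam) ** diag_matrix (\<lambda>i. 1 / (d i + lam)))"
    by (simp only: matrix_mul_assoc)
  also have "\<dots> = resolvent A lam ** U" by (simp add: diag_matrix_mult one del: times_divide_eq_right)
  finally show ?thesis
    by (simp add: matrix_mul_assoc resolvent_cancel(1)[of A, OF psd lam])
qed

text \<open>In an orthonormal eigenbasis \<open>A ** resolvent A lam\<close> is diagonal with the shrinkage factors
  \<open>\<nu> / (\<nu> + lam)\<close>. This is where the effective dimension of the nonparametric part comes from.\<close>
lemma trace_shrinkage_squared:
  fixes A :: "real ^ 'n ^ 'n"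
  assumes sym: "transpose A = A" and psd: "\<And>x. 0 \<le> x \<bullet> (A *v x)" and lam: "lam > 0"
  shows "trace ((A ** resolvent A lam) ** (A ** resolvent A lam))
    = (\<Sum>i = 1..CARD('n). (eigval_desc A i / (eigval_desc A i + lam))\<^sup>2)"
proof -
  obtain U d where U: "orthogonal_matrix U" and A: "A ** U = U ** diag_matrix d"
    using symmetric_matrix_diagonalizable[OF sym] .
  have d: "0 \<le> d i" for i
  proof -
    have n: "norm (column i U) = 1"
      using U by (simp add: orthogonal_matrix_orthonormal_columns)
    have "A *v column i U = column i (A ** U)"
      by (simp add: column_def matrix_matrix_mult_def matrix_vector_mult_def vec_eq_iff)
    also have "\<dots> = d i *\<^sub>R column i U" by (simp add: A matrix_mult_diag_column)
    finally show ?thesis using psd[of "column i U"] n by (simp add: norm_eq_1)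
  qed
  define T where "T = A ** resolvent A lam"
  have "T ** U = A ** (resolvent A lam ** U)" by (simp add: T_def matrix_mul_assoc)
  also have "\<dots> = U ** diag_matrix (\<lambda>i. d i / (d i + lam))"
    by (simp add: resolvent_diag[OF psd lam d A] matrix_mul_assoc A)
      (simp add: diag_matrix_mult flip: matrix_mul_assoc)
  finally have T: "T ** U = U ** diag_matrix (\<lambda>i. d i / (d i + lam))" .
  have "(T ** T) ** U = T ** (T ** U)" by (simp add: matrix_mul_assoc)
  also have "\<dots> = (T ** U) ** diag_matrix (\<lambda>i. d i / (d i + lam))"
    by (simp add: T matrix_mul_assoc)
  also have "\<dots> = U ** diag_matrix (\<lambda>i. (d i / (d i + lam))\<^sup>2)"
    by (simp add: T diag_matrix_mult power2_eq_square flip: matrix_mul_assoc)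
  finally have "trace (T ** T) = (\<Sum>i\<in>UNIV. (d i / (d i + lam))\<^sup>2)"
    by (rule trace_conjugated_diag[OF U])
  thus ?thesis
    using sum_eigval_desc[OF U A, of "\<lambda>x. (x / (x + lam))\<^sup>2"] by (simp add: T_def)
qed

section \<open>Projection onto the column space\<close>

text \<open>\<open>A\<^sup>T A x = 0\<close> gives \<open>\<bar>A x\<bar>\<^sup>2 = x \<bullet> A\<^sup>T A x = 0\<close>, and \<open>A\<close> is injective.\<close>
lemma invertible_gram_matrix:
  fixes A :: "real ^ 'd ^ 'n"
  assumes "rank A = CARD('d)"
  shows "invertible (transpose A ** A)"
proof -
  have "x = 0" if "(transpose A ** A) *v x = 0" for x
  proof -
    have "(A *v x) \<bullet> (A *v x) = x \<bullet> ((transpose A ** A) *v x)"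
      by (simp add: dot_lmul_matrix flip: matrix_vector_mul_assoc transpose_matrix_vector)
        (metis dot_lmul_matrix vector_transpose_matrix)
    hence "A *v x = A *v 0" using that by simp
    thus ?thesis using assms full_rank_injective[of A] by (simp only: inj_eq)
  qed
  thus ?thesis
    unfolding invertible_left_inverse matrix_left_invertible_ker by blast
qed

text \<open>The orthogonality conditions determine the projection uniquely, since the difference of two
  candidate projections of a vector lies in the column space and is orthogonal to it. The closed
  formula of least squares satisfies these conditions.\<close>
lemma proj_P_full_rank:
  fixes A :: "real ^ 'd ^ 'n"
  assumes rank: "rank A = CARD('d)"
  shows "proj_P A = A ** (matrix_inv (transpose A ** A) ** transpose A)"
proof -
  define V where "V = span (columns A)"
  define P where "P = A ** (matrix_inv (transpose A ** A) ** transpose A)"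
  let ?is = "\<lambda>P. \<forall>v. P *v v \<in> V \<and> (\<forall>w\<in>V. orthogonal (v - P *v v) w)"
  have "transpose A ** P = transpose A"
    using matrix_inv_cancel(1)[OF invertible_gram_matrix[OF rank]]
    by (simp add: P_def matrix_mul_assoc)
  hence 0: "transpose A *v (v - P *v v) = 0" for v
    by (simp add: matrix_vector_mult_diff_distrib matrix_vector_mul_assoc)
  have "?is P"
  proof (intro allI conjI ballI)
    fix v w
    show "P *v v \<in> V"
      unfolding V_def P_def
      by (simp add: matrix_vector_mult_in_columnspace flip: matrix_vector_mul_assoc)
    assume "w \<in> V"
    moreover have "orthogonal (v - P *v v) y" if y: "y \<in> columns A" for y
    proof -
      obtain i where i: "y = column i A" using y by (auto simp: columns_def)
      have "y \<bullet> (v - P *v v) = (transpose A *v (v - P *v v)) $ i"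
        by (simp add: i matrix_vector_mult_def column_def transpose_def inner_vec_def)
      thus ?thesis using 0 by (simp add: orthogonal_def inner_commute)
    qed
    ultimately show "orthogonal (v - P *v v) w"
      unfolding V_def by (rule orthogonal_to_span)
  qed
  moreover have "P' = P" if P': "?is P'" for P'
  proof -
    have "P' *v v = P *v v" for v
    proof -
      have "P' *v v - P *v v \<in> V"
        using P' \<open>?is P\<close> by (auto simp: V_def intro: span_diff)
      hence "(v - P *v v) \<bullet> (P' *v v - P *v v) = 0" "(v - P' *v v) \<bullet> (P' *v v - P *v v) = 0"
        using P' \<open>?is P\<close> by (auto simp: orthogonal_def)
      hence "(P' *v v - P *v v) \<bullet> (P' *v v - P *v v) = 0"
        by (simp add: inner_diff_left)
      thus ?thesis by simp
    qed
    thus ?thesis by (simp add: matrix_eq)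
  qed
  ultimately show ?thesis
    unfolding proj_P_def orth_proj_matrix_def V_def[symmetric] P_def[symmetric]
    by (rule the_equality)
qed

lemma transpose_proj_P:
  fixes A :: "real ^ 'd ^ 'n"
  assumes rank: "rank A = CARD('d)"
  shows "transpose (proj_P A) = proj_P A"
proof -
  define G where "G = transpose A ** A"
  define N where "N = matrix_inv G"
  have GN: "G ** N = mat 1" "N ** G = mat 1"
    using matrix_inv_cancel[OF invertible_gram_matrix[OF rank]] by (auto simp: G_def N_def)
  have "transpose G = G" by (simp add: G_def matrix_transpose_mul)
  hence "transpose N ** G = mat 1"
    using GN(1) by (metis matrix_transpose_mul transpose_mat)
  hence "transpose N = N"
    using GN(1) by (metis matrix_mul_assoc matrix_mul_lid matrix_mul_rid)
  thus ?thesis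
    by (simp add: proj_P_full_rank[OF rank] matrix_transpose_mul matrix_mul_assoc
        flip: G_def N_def)
qed

lemma proj_P_mult_self:
  fixes A :: "real ^ 'd ^ 'n"
  assumes rank: "rank A = CARD('d)"
  shows "proj_P A ** A = A"
  using matrix_inv_cancel(2)[OF invertible_gram_matrix[OF rank]]
  by (simp add: proj_P_full_rank[OF rank] flip: matrix_mul_assoc)

lemma proj_P_idempotent:
  fixes A :: "real ^ 'd ^ 'n"
  assumes rank: "rank A = CARD('d)"
  shows "proj_P A ** proj_P A = proj_P A"
  by (subst (2 3) proj_P_full_rank[OF rank]) (simp add: matrix_mul_assoc proj_P_mult_self[OF rank])

text \<open>Cycling the factors of the closed formula under the trace turns the projection into the
  \<open>d \<times> d\<close> identity matrix.\<close>
lemma trace_proj_P: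
  fixes A :: "real ^ 'd ^ 'n"
  assumes rank: "rank A = CARD('d)"
  shows "trace (proj_P A) = CARD('d)"
proof -
  have "trace (proj_P A) = trace (matrix_inv (transpose A ** A) ** transpose A ** A)"
    unfolding proj_P_full_rank[OF rank] by (rule trace_mul_sym)
  thus ?thesis
    using matrix_inv_cancel(2)[OF invertible_gram_matrix[OF rank]]
    by (simp add: trace_I flip: matrix_mul_assoc)
qed

lemma proj_P_range:
  fixes A :: "real ^ 'd ^ 'n"
  assumes rank: "rank A = CARD('d)"
  obtains \<alpha> where "proj_P A *v v = A *v \<alpha>"
  using that by (simp add: proj_P_full_rank[OF rank] flip: matrix_vector_mul_assoc)

lemma proj_Q_properties:
  fixes A :: "real ^ 'd ^ 'n"
  assumes rank: "rank A = CARD('d)"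
  shows "transpose (proj_Q A) = proj_Q A" "proj_Q A ** proj_Q A = proj_Q A"
    "transpose A ** proj_Q A = 0" "proj_P A ** proj_Q A = 0" "proj_Q A ** proj_P A = 0"
    "proj_P A + proj_Q A = mat 1"
proof -
  have t: "transpose (X - Y) = transpose X - transpose Y" for X Y :: "real ^ 'n ^ 'n"
    by (simp add: transpose_def vec_eq_iff)
  show "transpose (proj_Q A) = proj_Q A"
    by (simp add: proj_Q_def t transpose_proj_P[OF rank])
  show "proj_Q A ** proj_Q A = proj_Q A" "proj_P A ** proj_Q A = 0" "proj_Q A ** proj_P A = 0"
    by (simp_all add: proj_Q_def matrix_diff_ldistrib matrix_diff_rdistrib proj_P_idempotent[OF rank])
  have "transpose A ** proj_P A = transpose A"
    using arg_cong[OF proj_P_mult_self[OF rank], of transpose]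
    by (simp add: matrix_transpose_mul transpose_proj_P[OF rank])
  thus "transpose A ** proj_Q A = 0" by (simp add: proj_Q_def matrix_diff_ldistrib)
  show "proj_P A + proj_Q A = mat 1" by (simp add: proj_Q_def)
qed

section \<open>Finite kernel expansions\<close>

definition eval_vec :: "('n \<Rightarrow> 'a) \<Rightarrow> ('a \<Rightarrow> real) \<Rightarrow> real ^ 'n" where
  "eval_vec X f = (\<chi> i. f (X i))"

lemma eval_vec_nth [simp]: "eval_vec X f $ i = f (X i)"
  by (simp add: eval_vec_def)

definition kernel_expansion ::
  "'a set \<Rightarrow> ('a \<Rightarrow> 'a \<Rightarrow> real) \<Rightarrow> ('n::finite \<Rightarrow> 'a) \<Rightarrow> real ^ 'n \<Rightarrow> 'a \<Rightarrow> real" where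
  "kernel_expansion S K X c = (\<lambda>x. \<Sum>i\<in>UNIV. c $ i * kernel_section S K (X i) x)"

context hilbert_function_space
begin

lemma diff_mem: "f \<in> H \<Longrightarrow> g \<in> H \<Longrightarrow> (\<lambda>x. f x - g x) \<in> H"
  using add_mem[of f "\<lambda>x. - 1 * g x"] scale_mem[of g "- 1"] by simp

lemma ip_zero_left: "h \<in> H \<Longrightarrow> ip (\<lambda>_. 0) h = 0"
  using ip_scale_left[OF zero_mem, of h 0] by simp

lemma ip_add_self:
  assumes "f \<in> H" "g \<in> H"
  shows "ip (\<lambda>x. f x + g x) (\<lambda>x. f x + g x) = ip f f + 2 * ip f g + ip g g"
  using assms add_mem[OF assms]
  by (simp add: ip_add_left ip_commute[of _ "\<lambda>x. f x + g x"] ip_commute[of g f])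

lemma sum_mem:
  assumes "finite I" "\<And>i. i \<in> I \<Longrightarrow> F i \<in> H"
  shows "(\<lambda>x. \<Sum>i\<in>I. c i * F i x) \<in> H"
  using assms by (induction I rule: finite_induct) (auto intro!: zero_mem add_mem scale_mem)

lemma ip_sum_left:
  assumes "finite I" "\<And>i. i \<in> I \<Longrightarrow> F i \<in> H" "h \<in> H"
  shows "ip (\<lambda>x. \<Sum>i\<in>I. c i * F i x) h = (\<Sum>i\<in>I. c i * ip (F i) h)"
  using assms
proof (induction I rule: finite_induct)
  case (insert i I)
  have "(\<lambda>x. \<Sum>i\<in>I. c i * F i x) \<in> H" using insert by (intro sum_mem) auto
  thus ?case using insert by (simp add: ip_add_left ip_scale_left scale_mem)
qed (simp add: ip_zero_left)

lemma rkhs_norm_power2: "f \<in> H \<Longrightarrow> (rkhs_norm ip f)\<^sup>2 = ip f f"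
  by (simp add: rkhs_norm_def ip_nonneg)

end

context rkhs
begin

lemma kernel_expansion_mem:
  assumes "\<And>i. X i \<in> S"
  shows "kernel_expansion S K X c \<in> H"
  unfolding kernel_expansion_def using assms by (intro sum_mem) (auto intro: section_mem)

lemma ip_kernel_expansion:
  assumes "\<And>i. X i \<in> S" "f \<in> H"
  shows "ip (kernel_expansion S K X c) f = c \<bullet> eval_vec X f"
proof -
  have "ip (kernel_section S K (X i)) f = f (X i)" for i
    using assms reproducing[of f "X i"] by (simp add: ip_commute section_mem)
  thus ?thesis
    unfolding kernel_expansion_def using assms
    by (subst ip_sum_left) (auto simp: section_mem inner_vec_def)
qed

lemma eval_kernel_expansion:
  fixes X :: "'n::finite \<Rightarrow> 'a"
  assumes "\<And>i. X i \<in> S" "symmetric_kernel S K"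
  shows "eval_vec X (kernel_expansion S K X c) = real CARD('n) *\<^sub>R (kernel_matrix K X *v c)"
  using assms
  by (simp add: vec_eq_iff kernel_expansion_def kernel_section_def kernel_matrix_def
      matrix_vector_mult_def symmetric_kernel_def sum_distrib_left mult.commute[of "c $ _"])

lemma transpose_kernel_matrix:
  assumes "\<And>i. X i \<in> S" "symmetric_kernel S K"
  shows "transpose (kernel_matrix K X) = kernel_matrix K X"
  using assms by (simp add: transpose_def kernel_matrix_def vec_eq_iff symmetric_kernel_def)

text \<open>Up to the factor \<open>n\<close>, the quadratic form of the kernel matrix is the squared norm of the
  kernel expansion with the same coefficients.\<close>
lemma kernel_matrix_psd:
  fixes X :: "'n::finite \<Rightarrow> 'a"
  assumes X: "\<And>i. X i \<in> S" and sym: "symmetric_kernel S K"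
  shows "0 \<le> c \<bullet> (kernel_matrix K X *v c)"
proof -
  have "0 \<le> ip (kernel_expansion S K X c) (kernel_expansion S K X c)"
    by (intro ip_nonneg kernel_expansion_mem X)
  also have "\<dots> = real CARD('n) * (c \<bullet> (kernel_matrix K X *v c))"
    by (simp add: ip_kernel_expansion[of X] kernel_expansion_mem X eval_kernel_expansion[OF X sym])
  finally show ?thesis by (simp add: zero_le_mult_iff)
qed

end

section \<open>The penalised least squares fit\<close>

lemma norm_vec_power2: "(norm (v :: real ^ 'n))\<^sup>2 = (\<Sum>i\<in>UNIV. (v $ i)\<^sup>2)"
  by (simp add: power2_norm_eq_inner inner_vec_def) (simp add: power2_eq_square)

lemma pls_objective_norm:
  fixes X :: "'n::finite \<Rightarrow> real ^ 'd"
  shows "pls_objective ip lam X Y (\<alpha>, g) =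
    (norm (vec_lambda Y - design_matrix X *v \<alpha> - eval_vec X g))\<^sup>2 / real CARD('n)
    + lam * (rkhs_norm ip g)\<^sup>2"
proof -
  have "(design_matrix X *v \<alpha>) $ i = X i \<bullet> \<alpha>" for i
    by (simp add: matrix_vector_mul_component design_matrix_def)
  thus ?thesis
    by (simp add: pls_objective_def norm_vec_power2)
qed

text \<open>The objective is quadratic. Around a point that satisfies the two normal equations, one for
  the linear part and one for the function part, the linear term of its expansion vanishes, and
  what remains is, for \<open>lam \<ge> 0\<close>, a nonnegative quadratic form that controls the fitted values. So such
  a point is then a minimiser, and all minimisers have the same fitted values.\<close>
lemma pls_objective_decomposition:
  fixes X :: "'n::finite \<Rightarrow> real ^ 'd"
  assumes "rkhs S K H ip" and g0: "g\<^sub>0 \<in> H" and g: "g \<in> H"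
    and r: "r = vec_lambda Y - design_matrix X *v \<alpha>\<^sub>0 - eval_vec X g\<^sub>0"
    and normal_\<alpha>: "transpose (design_matrix X) *v r = 0"
    and normal_g: "\<forall>h\<in>H. r \<bullet> eval_vec X h = real CARD('n) * lam * ip g\<^sub>0 h"
  shows "pls_objective ip lam X Y (\<alpha>, g) = pls_objective ip lam X Y (\<alpha>\<^sub>0, g\<^sub>0)
    + (norm (design_matrix X *v (\<alpha> - \<alpha>\<^sub>0) + eval_vec X (\<lambda>x. g x - g\<^sub>0 x)))\<^sup>2 / real CARD('n)
    + lam * (rkhs_norm ip (\<lambda>x. g x - g\<^sub>0 x))\<^sup>2"
proof -
  interpret rkhs S K H ip by fact
  define h where "h = (\<lambda>x. g x - g\<^sub>0 x)"
  have h: "h \<in> H" using g g0 by (simp add: h_def diff_mem)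
  have gh: "g = (\<lambda>x. g\<^sub>0 x + h x)" by (simp add: h_def)
  define \<Delta> where "\<Delta> = design_matrix X *v (\<alpha> - \<alpha>\<^sub>0) + eval_vec X h"
  have "vec_lambda Y - design_matrix X *v \<alpha> - eval_vec X g = r - \<Delta>"
    by (simp add: r \<Delta>_def h_def vec_eq_iff matrix_vector_mult_diff_distrib)
  moreover have "r \<bullet> \<Delta> = real CARD('n) * lam * ip g\<^sub>0 h"
  proof -
    have "r \<bullet> (design_matrix X *v (\<alpha> - \<alpha>\<^sub>0)) = 0"
      using normal_\<alpha> by (simp flip: dot_lmul_matrix transpose_matrix_vector)
    thus ?thesis by (simp add: \<Delta>_def inner_add_right normal_g h)
  qed
  moreover have "(norm (r - \<Delta>))\<^sup>2 = (norm r)\<^sup>2 - 2 * (r \<bullet> \<Delta>) + (norm \<Delta>)\<^sup>2"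
    by (simp add: power2_norm_eq_inner inner_diff_left inner_diff_right inner_commute[of \<Delta> r])
  moreover have "ip g g = ip g\<^sub>0 g\<^sub>0 + 2 * ip g\<^sub>0 h + ip h h"
    by (subst (1 2) gh) (rule ip_add_self[OF g0 h])
  ultimately show ?thesis
    by (simp add: pls_objective_norm rkhs_norm_power2 g g0 h flip: h_def r \<Delta>_def)
      (simp add: field_simps)
qed

section \<open>The penalised fit as a linear smoother\<close>

definition projected_kernel_matrix ::
  "(real ^ 'd \<Rightarrow> real ^ 'd \<Rightarrow> real) \<Rightarrow> ('n::finite \<Rightarrow> real ^ 'd) \<Rightarrow> real ^ 'n ^ 'n" where
  "projected_kernel_matrix K X =
     proj_Q (design_matrix X) ** kernel_matrix K X ** proj_Q (design_matrix X)"

text \<open>The matrix that sends the data vector to the residual vector of the penalised fit; the fit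
  itself is the linear smoother \<open>mat 1 - residual_matrix K lam X\<close>.\<close>
definition residual_matrix ::
  "(real ^ 'd \<Rightarrow> real ^ 'd \<Rightarrow> real) \<Rightarrow> real \<Rightarrow> ('n::finite \<Rightarrow> real ^ 'd) \<Rightarrow> real ^ 'n ^ 'n" where
  "residual_matrix K lam X =
     lam *\<^sub>R (resolvent (projected_kernel_matrix K X) lam ** proj_Q (design_matrix X))"

locale pls_regression = rkhs S K H ip
  for S :: "(real ^ 'd) set" and K H ip +
  fixes X :: "'n::finite \<Rightarrow> real ^ 'd" and lam :: real
  assumes design: "X i \<in> S"
    and K_sym: "symmetric_kernel S K"
    and full_rank: "rank (design_matrix X) = CARD('d)"
    and lam_pos: "lam > 0"
begin

abbreviation "Z \<equiv> design_matrix X"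
abbreviation "P \<equiv> proj_P Z"
abbreviation "Q \<equiv> proj_Q Z"
abbreviation "A \<equiv> projected_kernel_matrix K X"
abbreviation "R \<equiv> resolvent A lam"
abbreviation "W \<equiv> residual_matrix K lam X"

lemmas Q_simps = proj_Q_properties[OF full_rank]

lemma transpose_A: "transpose A = A"
  by (simp add: projected_kernel_matrix_def matrix_transpose_mul Q_simps matrix_mul_assoc
      transpose_kernel_matrix[of X, OF design K_sym])

lemma A_psd: "0 \<le> x \<bullet> (A *v x)"
proof -
  have "x \<bullet> (A *v x) = (Q *v x) \<bullet> (kernel_matrix K X *v (Q *v x))"
    unfolding projected_kernel_matrix_def
    by (simp add: symmetric_matrix_inner[OF Q_simps(1)] flip: matrix_vector_mul_assoc)
  thus ?thesis using kernel_matrix_psd[of X, OF design K_sym] by simp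
qed

lemma A_mult_Q: "A ** Q = A" "Q ** A = A"
  unfolding projected_kernel_matrix_def
  by (simp_all add: matrix_mul_assoc Q_simps) (simp_all add: Q_simps flip: matrix_mul_assoc)

lemma A_mult_P: "A ** P = 0" "P ** A = 0"
proof -
  have "A ** P = A ** (Q ** P)" "P ** A = P ** Q ** A"
    by (simp_all only: matrix_mul_assoc A_mult_Q) (simp only: A_mult_Q flip: matrix_mul_assoc)
  thus "A ** P = 0" "P ** A = 0" by (simp_all add: Q_simps)
qed

lemmas R_cancel = resolvent_cancel[of A lam, OF A_psd lam_pos]

text \<open>\<open>Q\<close> commutes with \<open>A\<close>, because \<open>A\<close> absorbs it on either side, hence also with the inverse of
  \<open>A + lam\<close>.\<close>
lemma Q_mult_R: "Q ** R = R ** Q"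
proof -
  have "shift A lam ** Q = Q ** shift A lam"
    by (simp add: shift_def matrix_add_rdistrib matrix_add_ldistrib A_mult_Q matrix_mult_scaleR_id)
  hence "R ** (shift A lam ** Q) ** R = R ** (Q ** shift A lam) ** R" by simp
  hence "(R ** shift A lam) ** Q ** R = R ** Q ** (shift A lam ** R)"
    by (simp add: matrix_mul_assoc)
  thus ?thesis by (simp add: R_cancel)
qed

lemma A_mult_R: "A ** R = mat 1 - lam *\<^sub>R R" "R ** A = mat 1 - lam *\<^sub>R R"
  using R_cancel
  by (simp_all add: shift_def matrix_add_rdistrib matrix_add_ldistrib matrix_mult_scaleR_id
      algebra_simps)

text \<open>The smoother splits into an unpenalised projection onto the linear part and a shrinkage
  operator that lives on the orthogonal complement.\<close>
lemma smoother_eq: "mat 1 - W = P + A ** R"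
proof -
  have "A ** R = A ** Q ** R" by (simp add: A_mult_Q)
  also have "\<dots> = A ** R ** Q" by (simp add: Q_mult_R flip: matrix_mul_assoc)
  also have "\<dots> = Q - W"
    by (simp add: A_mult_R matrix_diff_rdistrib residual_matrix_def scalar_matrix_assoc)
  finally show ?thesis using Q_simps(6) by (simp add: algebra_simps)
qed

lemma Q_mult_W: "W ** Q = W" "Q ** W = W"
proof -
  show "W ** Q = W"
    by (simp add: residual_matrix_def Q_simps flip: scalar_matrix_assoc matrix_mul_assoc)
  have "Q ** (R ** Q) = R ** Q" by (simp add: matrix_mul_assoc Q_mult_R)
    (simp add: Q_simps flip: matrix_mul_assoc)
  thus "Q ** W = W"
    by (simp add: residual_matrix_def matrix_scalar_ac flip: scalar_matrix_assoc)
qed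

lemma transpose_W: "transpose W = W"
proof -
  have "transpose (shift A lam) = shift A lam"
    using transpose_A by (auto simp: shift_def transpose_def vec_eq_iff mat_def)
  hence "transpose R ** shift A lam = mat 1"
    using R_cancel(2) by (metis matrix_transpose_mul transpose_mat)
  hence "transpose R = R"
    using R_cancel(2) by (metis matrix_mul_assoc matrix_mul_lid matrix_mul_rid)
  thus ?thesis
    by (simp add: residual_matrix_def transpose_scalar matrix_transpose_mul Q_simps Q_mult_R)
qed

text \<open>The two summands of the smoother annihilate each other, so their squares contribute
  separately: \<open>P\<close> is idempotent with trace \<open>d\<close>, and the shrinkage part contributes the squared
  shrinkage factors.\<close>
lemma trace_smoother_squared:
  "trace ((mat 1 - W) ** (mat 1 - W)) = CARD('d)
    + (\<Sum>i = 1..CARD('n). (eigval_desc A i / (eigval_desc A i + lam))\<^sup>2)"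
proof -
  have "P ** (A ** R) = 0" by (simp add: matrix_mul_assoc A_mult_P)
  moreover have "(A ** R) ** P = R ** (A ** P)"
    by (simp add: A_mult_R flip: matrix_mul_assoc) (simp add: matrix_mul_assoc A_mult_R)
  hence "(A ** R) ** P = 0" by (simp add: A_mult_P)
  ultimately have "(mat 1 - W) ** (mat 1 - W) = P + (A ** R) ** (A ** R)"
    unfolding smoother_eq
    by (simp add: matrix_add_ldistrib matrix_add_rdistrib proj_P_idempotent[OF full_rank])
  thus ?thesis
    by (simp add: trace_add trace_proj_P[OF full_rank]
        trace_shrinkage_squared[OF transpose_A A_psd lam_pos])
qed

text \<open>The function part is sought as a kernel expansion whose coefficients are proportional to the
  residual. The normal equation for the function part is then the reproducing property. The
  coefficients are chosen such that \<open>Q\<close> annihilates what remains of the data after subtracting the residual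
  and the function part; this remainder then lies in the column space and is the linear part.\<close>
lemma minimiser_exists:
  obtains \<alpha>\<^sub>0 g\<^sub>0 where "g\<^sub>0 \<in> H" "W *v y = y - Z *v \<alpha>\<^sub>0 - eval_vec X g\<^sub>0"
    "transpose Z *v (W *v y) = 0"
    "\<forall>h\<in>H. (W *v y) \<bullet> eval_vec X h = real CARD('n) * lam * ip g\<^sub>0 h"
proof -
  define k where "k = kernel_matrix K X"
  \<comment> \<open>The factor \<open>1 / n\<close> cancels the \<open>n\<close> by which the Gram matrix of the kernel sections exceeds the
     kernel matrix.\<close>
  define c where "c = (1 / real CARD('n)) *\<^sub>R (R *v (Q *v y))"
  define g\<^sub>0 where "g\<^sub>0 = kernel_expansion S K X c"
  have Wy: "W *v y = (real CARD('n) * lam) *\<^sub>R c"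
    by (simp add: residual_matrix_def c_def matrix_vector_mul_assoc flip: scaleR_matrix_vector_assoc)
  have ev: "eval_vec X g\<^sub>0 = k *v (R *v (Q *v y))"
    by (simp add: g\<^sub>0_def eval_kernel_expansion[of X, OF design K_sym] c_def
        matrix_vector_mult_scaleR k_def)
  define u where "u = y - W *v y - eval_vec X g\<^sub>0"
  have "Q *v u = 0"
  proof -
    have "Q ** k ** (R ** Q) = Q ** k ** (Q ** R)" by (simp add: Q_mult_R)
    also have "\<dots> = A ** R" by (simp add: projected_kernel_matrix_def k_def matrix_mul_assoc)
    also have "\<dots> = Q - W"
      using smoother_eq Q_simps(6) by (simp add: algebra_simps)
    finally have "Q *v eval_vec X g\<^sub>0 = Q *v y - W *v y"
      by (simp add: ev matrix_vector_mul_assoc matrix_mul_assoc flip: matrix_vector_mult_diff_rdistrib)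
    moreover have "Q *v (W *v y) = W *v y" by (simp add: matrix_vector_mul_assoc Q_mult_W)
    ultimately show ?thesis by (simp add: u_def matrix_vector_mult_diff_distrib)
  qed
  hence "u = P *v u"
    using Q_simps(6) matrix_vector_mult_add_rdistrib[of P Q u] by simp
  then obtain \<alpha>\<^sub>0 where \<alpha>: "u = Z *v \<alpha>\<^sub>0"
    using proj_P_range[OF full_rank, of u] by metis
  show thesis
  proof
    show "g\<^sub>0 \<in> H" by (simp add: g\<^sub>0_def kernel_expansion_mem design)
    show "W *v y = y - Z *v \<alpha>\<^sub>0 - eval_vec X g\<^sub>0" by (simp add: u_def flip: \<alpha>)
    have "transpose Z ** (Q ** W) = 0" by (simp add: matrix_mul_assoc Q_simps)
    thus "transpose Z *v (W *v y) = 0" by (simp add: matrix_vector_mul_assoc Q_mult_W)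
    show "\<forall>h\<in>H. (W *v y) \<bullet> eval_vec X h = real CARD('n) * lam * ip g\<^sub>0 h"
      by (simp add: Wy g\<^sub>0_def ip_kernel_expansion[of X, OF design])
  qed
qed

text \<open>The minimal value of the objective is the mean squared residual plus a nonnegative penalty.
  On noise-free data this bounds the squared bias by the approximation error.\<close>
lemma residual_le_objective:
  assumes "g \<in> H"
  shows "(norm (W *v vec_lambda Y))\<^sup>2 / real CARD('n) \<le> pls_objective ip lam X Y (\<alpha>, g)"
proof -
  obtain \<alpha>\<^sub>0 g\<^sub>0 where g0: "g\<^sub>0 \<in> H"
    and r: "W *v vec_lambda Y = vec_lambda Y - Z *v \<alpha>\<^sub>0 - eval_vec X g\<^sub>0"
    and n: "transpose Z *v (W *v vec_lambda Y) = 0"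
      "\<forall>h\<in>H. (W *v vec_lambda Y) \<bullet> eval_vec X h = real CARD('n) * lam * ip g\<^sub>0 h"
    by (rule minimiser_exists[of "vec_lambda Y"]) (rule that)
  have "(norm (W *v vec_lambda Y))\<^sup>2 / real CARD('n) \<le> pls_objective ip lam X Y (\<alpha>\<^sub>0, g\<^sub>0)"
    using lam_pos by (simp add: pls_objective_norm r)
  also have "\<dots> \<le> pls_objective ip lam X Y (\<alpha>, g)"
    by (subst pls_objective_decomposition[OF rkhs_axioms g0 assms r n, of \<alpha>])
      (simp add: lam_pos less_imp_le)
  finally show ?thesis .
qed

text \<open>For any minimiser the excess over the value at a solution of the normal equations vanishes, which
  forces equal fitted values. The risk sees the pair chosen by \<open>arg_min\<close> only through its values at the
  design points.\<close>
lemma eval_pls_fit: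
  "eval_vec X (pls_fit H ip lam X Y) = (mat 1 - W) *v vec_lambda Y"
proof -
  obtain \<alpha>\<^sub>0 g\<^sub>0 where g0: "g\<^sub>0 \<in> H"
    and r: "W *v vec_lambda Y = vec_lambda Y - Z *v \<alpha>\<^sub>0 - eval_vec X g\<^sub>0"
    and n: "transpose Z *v (W *v vec_lambda Y) = 0"
      "\<forall>h\<in>H. (W *v vec_lambda Y) \<bullet> eval_vec X h = real CARD('n) * lam * ip g\<^sub>0 h"
    by (rule minimiser_exists[of "vec_lambda Y"]) (rule that)
  note dec = pls_objective_decomposition[OF rkhs_axioms g0 _ r n]
  let ?J = "pls_objective ip lam X Y"
  have min: "?J (\<alpha>\<^sub>0, g\<^sub>0) \<le> ?J (\<alpha>, g)" if "g \<in> H" for \<alpha> g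
    by (subst dec[OF that, of \<alpha>]) (simp add: lam_pos less_imp_le)
  obtain \<alpha> g where \<alpha>g: "pls_argmin H ip lam X Y = (\<alpha>, g)" by fastforce
  have "case pls_argmin H ip lam X Y of (\<alpha>, g) \<Rightarrow> g \<in> H \<and> ?J (\<alpha>, g) \<le> ?J (\<alpha>\<^sub>0, g\<^sub>0)"
    unfolding pls_argmin_def
    by (rule arg_minI[where x = "(\<alpha>\<^sub>0, g\<^sub>0)"]) (use g0 min in \<open>auto simp: not_less\<close>)
  hence g: "g \<in> H" "?J (\<alpha>, g) \<le> ?J (\<alpha>\<^sub>0, g\<^sub>0)" by (simp_all add: \<alpha>g)
  define \<Delta> where "\<Delta> = Z *v (\<alpha> - \<alpha>\<^sub>0) + eval_vec X (\<lambda>x. g x - g\<^sub>0 x)"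
  have "0 \<le> lam * (rkhs_norm ip (\<lambda>x. g x - g\<^sub>0 x))\<^sup>2" using lam_pos by simp
  hence "(norm \<Delta>)\<^sup>2 / real CARD('n) \<le> 0"
    using g(2) dec[OF g(1), of \<alpha>] unfolding \<Delta>_def by linarith
  hence "\<Delta> = 0" by (simp add: divide_le_0_iff)
  have "eval_vec X (pls_fit H ip lam X Y) = Z *v \<alpha> + eval_vec X g"
  proof (rule vec_eq_iff[THEN iffD2], rule allI)
    fix i
    have "(Z *v \<alpha>) $ i = X i \<bullet> \<alpha>"
      by (simp add: matrix_vector_mul_component design_matrix_def)
    thus "eval_vec X (pls_fit H ip lam X Y) $ i = (Z *v \<alpha> + eval_vec X g) $ i"
      by (simp add: pls_fit_def \<alpha>g)
  qed
  also have "\<dots> = Z *v \<alpha>\<^sub>0 + eval_vec X g\<^sub>0 + \<Delta>"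
  proof -
    have "eval_vec X (\<lambda>x. g x - g\<^sub>0 x) = eval_vec X g - eval_vec X g\<^sub>0" by (simp add: vec_eq_iff)
    thus ?thesis unfolding \<Delta>_def matrix_vector_mult_diff_distrib by simp
  qed
  also have "\<dots> = vec_lambda Y - W *v vec_lambda Y" unfolding r \<open>\<Delta> = 0\<close> by simp
  finally show ?thesis by (simp add: matrix_vector_mult_diff_rdistrib)
qed

end

section \<open>Second moments of affine functions of the noise\<close>

text \<open>The cross terms vanish because distinct noise variables are uncorrelated and centred.\<close>
lemma (in prob_space) affine_noise_second_moment:
  fixes eps :: "'n::finite \<Rightarrow> 'a \<Rightarrow> real"
  assumes indep: "indep_vars (\<lambda>_. borel) eps UNIV"
    and square_integrable: "\<And>i. integrable M (\<lambda>\<omega>. (eps i \<omega>)\<^sup>2)"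
    and mean_zero: "\<And>i. expectation (eps i) = 0"
    and variance: "\<And>i. expectation (\<lambda>\<omega>. (eps i \<omega>)\<^sup>2) = \<sigma>\<^sup>2"
  shows "expectation (\<lambda>\<omega>. (b + (\<Sum>j\<in>UNIV. a j * eps j \<omega>))\<^sup>2) = b\<^sup>2 + \<sigma>\<^sup>2 * (\<Sum>j\<in>UNIV. (a j)\<^sup>2)"
proof -
  have meas: "eps i \<in> borel_measurable M" for i
    using indep by (simp add: indep_vars_def)
  have int: "integrable M (eps i)" for i
    using square_integrable_imp_integrable[OF meas square_integrable] .
  have prod: "integrable M (\<lambda>\<omega>. eps i \<omega> * eps j \<omega>)
      \<and> expectation (\<lambda>\<omega>. eps i \<omega> * eps j \<omega>) = (if i = j then \<sigma>\<^sup>2 else 0)" for i j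
  proof (cases "i = j")
    case True
    thus ?thesis
      using square_integrable[of i] variance[of i] by (simp add: power2_eq_square)
  next
    case False
    have ij: "indep_vars (\<lambda>_. borel) eps {i, j}" by (rule indep_vars_subset[OF indep]) simp
    show ?thesis
      using indep_vars_integrable[OF _ ij] indep_vars_lebesgue_integral[OF _ ij] False
      by (simp add: int mean_zero)
  qed
  have expand: "(b + (\<Sum>j\<in>UNIV. a j * eps j \<omega>))\<^sup>2 = b\<^sup>2 + (\<Sum>j\<in>UNIV. 2 * b * a j * eps j \<omega>)
      + (\<Sum>i\<in>UNIV. \<Sum>j\<in>UNIV. a i * a j * (eps i \<omega> * eps j \<omega>))" for \<omega>
  proof -
    have "(\<Sum>j\<in>UNIV. a j * eps j \<omega>)\<^sup>2 = (\<Sum>i\<in>UNIV. \<Sum>j\<in>UNIV. a i * a j * (eps i \<omega> * eps j \<omega>))"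
      unfolding power2_eq_square sum_product
      by (intro sum.cong refl) algebra
    thus ?thesis by (simp add: power2_sum sum_distrib_left mult.assoc)
  qed
  have "expectation (\<lambda>\<omega>. (b + (\<Sum>j\<in>UNIV. a j * eps j \<omega>))\<^sup>2)
      = b\<^sup>2 + (\<Sum>i\<in>UNIV. \<Sum>j\<in>UNIV. a i * a j * (if i = j then \<sigma>\<^sup>2 else 0))"
    unfolding expand using prod int by (simp add: mean_zero prob_space)
  also have "(\<Sum>i\<in>UNIV. \<Sum>j\<in>UNIV. a i * a j * (if i = j then \<sigma>\<^sup>2 else 0)) = (\<Sum>i\<in>UNIV. a i * a i * \<sigma>\<^sup>2)"
  proof (rule sum.cong[OF refl])
    fix i
    show "(\<Sum>j\<in>UNIV. a i * a j * (if i = j then \<sigma>\<^sup>2 else 0)) = a i * a i * \<sigma>\<^sup>2"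
      by (subst sum.remove[of _ i]) (auto intro!: sum.neutral)
  qed
  also have "\<dots> = \<sigma>\<^sup>2 * (\<Sum>j\<in>UNIV. (a j)\<^sup>2)"
    unfolding sum_distrib_left by (intro sum.cong refl) algebra
  finally show ?thesis .
qed

section \<open>The risk bound\<close>

text \<open>The bias-variance decomposition of a symmetric linear smoother \<open>B = mat 1 - W\<close>: the noise
  contributes \<open>\<sigma>\<^sup>2\<close> times the squared Frobenius norm of \<open>B\<close>, which is the trace of \<open>B\<^sup>2\<close>.\<close>
lemma (in pls_regression) risk_pls_fit:
  fixes eps :: "'n \<Rightarrow> 'w \<Rightarrow> real"
  assumes "prob_space M" and indep: "prob_space.indep_vars M (\<lambda>_. borel) eps UNIV"
    and square_integrable: "\<And>i. integrable M (\<lambda>\<omega>. (eps i \<omega>)\<^sup>2)"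
    and mean_zero: "\<And>i. (\<integral>\<omega>. eps i \<omega> \<partial>M) = 0"
    and variance: "\<And>i. (\<integral>\<omega>. (eps i \<omega>)\<^sup>2 \<partial>M) = \<sigma>\<^sup>2"
  shows "risk M X (\<lambda>\<omega> x. pls_fit H ip lam X (\<lambda>i. fstar (X i) + eps i \<omega>) x - fstar x)
    = (norm (W *v eval_vec X fstar))\<^sup>2 / real CARD('n)
      + \<sigma>\<^sup>2 / real CARD('n) * trace ((mat 1 - W) ** (mat 1 - W))"
proof -
  interpret prob_space M by fact
  define B where "B = mat 1 - W"
  let ?b = "- (W *v eval_vec X fstar)"
  have "pls_fit H ip lam X (\<lambda>i. fstar (X i) + eps i \<omega>) (X i) - fstar (X i)
      = ?b $ i + (\<Sum>j\<in>UNIV. B $ i $ j * eps j \<omega>)" for i \<omega>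
  proof -
    have "(\<chi> i. fstar (X i) + eps i \<omega>) = eval_vec X fstar + (\<chi> i. eps i \<omega>)"
      by (simp add: vec_eq_iff)
    hence "eval_vec X (pls_fit H ip lam X (\<lambda>i. fstar (X i) + eps i \<omega>))
        = eval_vec X fstar + ?b + B *v (\<chi> i. eps i \<omega>)"
      by (simp add: eval_pls_fit B_def matrix_vector_right_distrib matrix_vector_mult_diff_rdistrib)
    from arg_cong[OF this, of "\<lambda>v. v $ i"] show ?thesis
      by (simp add: matrix_vector_mult_def[of B])
  qed
  hence "risk M X (\<lambda>\<omega> x. pls_fit H ip lam X (\<lambda>i. fstar (X i) + eps i \<omega>) x - fstar x)
      = (\<Sum>i\<in>UNIV. (?b $ i)\<^sup>2 + \<sigma>\<^sup>2 * (\<Sum>j\<in>UNIV. (B $ i $ j)\<^sup>2)) / real CARD('n)"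
    by (simp only: risk_def affine_noise_second_moment[OF indep square_integrable mean_zero variance])
  also have "(\<Sum>i\<in>UNIV. (?b $ i)\<^sup>2 + \<sigma>\<^sup>2 * (\<Sum>j\<in>UNIV. (B $ i $ j)\<^sup>2))
      = (norm (W *v eval_vec X fstar))\<^sup>2 + \<sigma>\<^sup>2 * (\<Sum>i\<in>UNIV. \<Sum>j\<in>UNIV. (B $ i $ j)\<^sup>2)"
    by (simp add: sum.distrib norm_vec_power2 sum_distrib_left)
  also have "(\<Sum>i\<in>UNIV. \<Sum>j\<in>UNIV. (B $ i $ j)\<^sup>2) = trace (B ** transpose B)"
    by (simp add: trace_def matrix_matrix_mult_def transpose_def power2_eq_square)
  also have "transpose B = B"
    using transpose_W by (auto simp: B_def transpose_def vec_eq_iff mat_def)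
  finally show ?thesis by (simp add: B_def add_divide_distrib)
qed

theorem theorem2:
  fixes S :: "(real ^ 'd) set"
    and X :: "'n::finite \<Rightarrow> real ^ 'd"
    and K :: "real ^ 'd \<Rightarrow> real ^ 'd \<Rightarrow> real"
    and H :: "(real ^ 'd \<Rightarrow> real) set"
    and ip :: "(real ^ 'd \<Rightarrow> real) \<Rightarrow> (real ^ 'd \<Rightarrow> real) \<Rightarrow> real"
    and fstar :: "real ^ 'd \<Rightarrow> real"
    and M :: "'w measure"
    and eps :: "'n \<Rightarrow> 'w \<Rightarrow> real"
    and Y :: "'n \<Rightarrow> 'w \<Rightarrow> real"
    and \<sigma> lam :: real
  assumes design: "\<And>i. X i \<in> S"
    and prob: "prob_space M"
    and indep: "prob_space.indep_vars M (\<lambda>_. borel) eps UNIV"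
    and square_integrable: "\<And>i. integrable M (\<lambda>\<omega>. (eps i \<omega>)\<^sup>2)"
    and mean_zero: "\<And>i. (\<integral>\<omega>. eps i \<omega> \<partial>M) = 0"
    and variance: "\<And>i. (\<integral>\<omega>. (eps i \<omega>)\<^sup>2 \<partial>M) = \<sigma>\<^sup>2"
    and model: "\<And>i \<omega>. Y i \<omega> = fstar (X i) + eps i \<omega>"
    and K_sym: "symmetric_kernel S K"
    and K_psd: "psd_kernel S K"
    and H_rkhs: "rkhs S K H ip"
    and full_rank: "rank (design_matrix X) = CARD('d)"
    and lam_pos: "lam > 0"
  shows "risk M X (\<lambda>\<omega> x. pls_fit H ip lam X (\<lambda>i. Y i \<omega>) x - fstar x)
    \<le> (INF (\<alpha>, f) \<in> UNIV \<times> H.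
          risk M X (\<lambda>\<omega> x. \<alpha> \<bullet> x + f x - fstar x) + lam * (rkhs_norm ip f)\<^sup>2)
      + \<sigma>\<^sup>2 / real CARD('n) *
        (real CARD('d) +
         (\<Sum>i = 1..CARD('n).
            let \<nu> = eigval_desc
              (proj_Q (design_matrix X) ** kernel_matrix K X ** proj_Q (design_matrix X)) i
            in (\<nu> / (\<nu> + lam))\<^sup>2))"
proof -
  interpret rkhs S K H ip by fact
  interpret pls_regression S K H ip X lam
    by unfold_locales (fact design K_sym full_rank lam_pos)+
  interpret prob_space M by fact
  have bias: "(norm (W *v eval_vec X fstar))\<^sup>2 / real CARD('n)
      \<le> (INF (\<alpha>, f) \<in> UNIV \<times> H.
          risk M X (\<lambda>\<omega> x. \<alpha> \<bullet> x + f x - fstar x) + lam * (rkhs_norm ip f)\<^sup>2)"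
  proof (rule cINF_greatest)
    show "UNIV \<times> H \<noteq> {}" using zero_mem by blast
    fix p :: "(real ^ 'd) \<times> (real ^ 'd \<Rightarrow> real)" assume "p \<in> UNIV \<times> H"
    then obtain \<alpha> f where p: "p = (\<alpha>, f)" "f \<in> H" by auto
    \<comment> \<open>For a nonrandom competitor the penalised risk is the objective on noise-free data.\<close>
    have "risk M X (\<lambda>\<omega> x. \<alpha> \<bullet> x + f x - fstar x) + lam * (rkhs_norm ip f)\<^sup>2
        = pls_objective ip lam X (\<lambda>i. fstar (X i)) (\<alpha>, f)"
      by (simp add: risk_def pls_objective_def prob_space inner_commute[of \<alpha>]
          power2_commute[of "_ + _" "fstar _"] diff_diff_eq)
    thus "(norm (W *v eval_vec X fstar))\<^sup>2 / real CARD('n) \<le> (case p of (\<alpha>, f) \<Rightarrow>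
        risk M X (\<lambda>\<omega> x. \<alpha> \<bullet> x + f x - fstar x) + lam * (rkhs_norm ip f)\<^sup>2)"
      using residual_le_objective[OF p(2), of "\<lambda>i. fstar (X i)" \<alpha>] by (simp add: p eval_vec_def)
  qed
  have "risk M X (\<lambda>\<omega> x. pls_fit H ip lam X (\<lambda>i. Y i \<omega>) x - fstar x)
      = (norm (W *v eval_vec X fstar))\<^sup>2 / real CARD('n)
        + \<sigma>\<^sup>2 / real CARD('n) * trace ((mat 1 - W) ** (mat 1 - W))"
    unfolding model
    by (rule risk_pls_fit[OF prob indep square_integrable mean_zero variance])
  with bias show ?thesis
    by (simp add: trace_smoother_squared Let_def projected_kernel_matrix_def)
qed

end
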